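(* We have $\mathrm{tot}_n(123)=(n-2)3^{n-3}$ for $n \geq 2$ and $$f_n(123)=1+\sum_{j=2}^n\sum_{\ell=1}^{j-1}\binom{j-2}{\ell-1}\binom{n-j+\ell}{j-1}, \qquad n \geq 1.$$
   Context: A Catalan word of length $n\geq 1$ is an integer sequence $\pi=\pi_1\cdots\pi_n$ with $\pi_1=1$ and $1\leq \pi_{i+1}\leq \pi_i+1$ for $1\leq i\leq n-1$. A (weakly) increasing run of a word is a maximal nondecreasing string of consecutive letters. A Catalan word is flattened if the sequence of first letters of its increasing runs, read from left to right, is nondecreasing. $\mathcal{F}_n$ is the set of flattened Catalan words of length $n$. An occurrence of a pattern $\tau=\tau_1\cdots\tau_m$ in $\pi$ as a consecutive (subword) pattern is an index $i$ such that $\pi_i\pi_{i+1}\cdots\pi_{i+m-1}$ is order-isomorphic to $\tau$; $\pi$ avoids $\tau$ if it has no occurrence of $\tau$. $\mathrm{tot}_n(\tau)$ denotes the total number of occurrences of $\tau$ in all the members of $\mathcal{F}_n$, and $f_n(\tau)$ denotes the number of members of $\mathcal{F}_n$ that avoid $\tau$. Binomial coefficients $\binom{a}{b}$ with $0\leq a<b$ are zero. *)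

theory Defs
  imports Complex_Main
begin

text \<open>Words are lists of natural numbers; positions are counted from 0. All letters of a
  Catalan word are at least 1, so natural numbers suffice.\<close>

definition catalan_word :: "nat list \<Rightarrow> bool" where
  "catalan_word w \<longleftrightarrow> w \<noteq> [] \<and> w ! 0 = 1 \<and>
     (\<forall>i. Suc i < length w \<longrightarrow> 1 \<le> w ! Suc i \<and> w ! Suc i \<le> w ! i + 1)"

text \<open>A factor is given by the half-open interval \<open>{i..<j}\<close> of positions it occupies.\<close>

definition nondecreasing_factor :: "nat list \<Rightarrow> nat \<Rightarrow> nat \<Rightarrow> bool" where
  "nondecreasing_factor w i j \<longleftrightarrow> i < j \<and> j \<le> length w \<and> sorted (take (j - i) (drop i w))"

definition increasing_run :: "nat list \<Rightarrow> nat \<Rightarrow> nat \<Rightarrow> bool" where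
  "increasing_run w i j \<longleftrightarrow> nondecreasing_factor w i j \<and>
     (\<forall>i' j'. i' \<le> i \<and> j \<le> j' \<and> nondecreasing_factor w i' j' \<longrightarrow> i' = i \<and> j' = j)"

definition run_first_letters :: "nat list \<Rightarrow> nat list" where
  "run_first_letters w =
     map (\<lambda>i. w ! i) (filter (\<lambda>i. \<exists>j. increasing_run w i j) [0..<length w])"

definition flattened_catalan_words :: "nat \<Rightarrow> nat list set" where
  "flattened_catalan_words n =
     {w. length w = n \<and> catalan_word w \<and> sorted (run_first_letters w)}"

definition order_isomorphic :: "nat list \<Rightarrow> nat list \<Rightarrow> bool" where
  "order_isomorphic u v \<longleftrightarrow> length u = length v \<and>
     (\<forall>a < length u. \<forall>b < length u. u ! a < u ! b \<longleftrightarrow> v ! a < v ! b)"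

definition occurrences :: "nat list \<Rightarrow> nat list \<Rightarrow> nat set" where
  "occurrences p w =
     {i. i + length p \<le> length w \<and> order_isomorphic (take (length p) (drop i w)) p}"

definition avoids :: "nat list \<Rightarrow> nat list \<Rightarrow> bool" where
  "avoids w p \<longleftrightarrow> occurrences p w = {}"

definition tot :: "nat \<Rightarrow> nat list \<Rightarrow> nat" where
  "tot n p = (\<Sum>w\<in>flattened_catalan_words n. card (occurrences p w))"

definition num_avoiding :: "nat \<Rightarrow> nat list \<Rightarrow> nat" where
  "num_avoiding n p = card {w \<in> flattened_catalan_words n. avoids w p}"

end

theory Submission
  imports Defs
begin

text \<open>
  Reading a flattened Catalan word from left to right, the letters that may follow a prefix
  depend only on its last letter \<open>x\<close> and on the first letter \<open>m\<close> of its last increasing run: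
  one may rise to \<open>x + 1\<close>, stay at \<open>x\<close>, or open a new run with any of the letters
  \<open>m, \<dots>, x - 1\<close>. Only the height \<open>d = x - m\<close> matters: a rise increases it by one, a repetition
  keeps it, and each of the \<open>d\<close> possible descents resets it to zero
  (\<open>sum_continuations_Suc\<close>). Hence a weighted count \<open>T\<^sub>n(d)\<close> of the continuations of length
  \<open>n\<close> satisfies a recurrence of the shape
  \<open>T\<^sub>n\<^sub>+\<^sub>1(d) = T\<^sub>n(d + 1) + T\<^sub>n(d) + d T\<^sub>n(0)\<close>, which preserves affine functions of \<open>d\<close>.
  So for each statistic it is enough to find the two coefficients of an affine function, as
  sequences in \<open>n\<close>, and to verify them by induction on \<open>n\<close>.

  Three consecutive letters form the pattern 123 exactly when both steps between them are rises.
  The statistic is therefore followed by remembering one extra bit, namely whether the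
  last step was a rise
  (\<open>card_occurrences_123\<close>). For the total number of occurrences the coefficients are
  combinations of \<open>1\<close>, \<open>3\<^sup>n\<close> and \<open>n 3\<^sup>n\<close>, which at height zero gives the first formula
  (\<open>total_double_rises_False\<close>).

  For the avoiders the coefficients are governed by a sequence \<open>L\<close> with \<open>L\<^sub>0 = 0\<close>,
  \<open>L\<^sub>1 = 1\<close> and \<open>L\<^sub>n\<^sub>+\<^sub>2 = 2 L\<^sub>n\<^sub>+\<^sub>1 + L\<^sub>n + 1\<close> (\<open>count_double_rise_free_eq\<close>). The inner sum of the
  binomial double sum is, for each \<open>k = j - 2\<close>, the coefficient of \<open>z\<^sup>n\<^sup>-\<^sup>1\<close> in
  \<open>z\<^sup>k\<^sup>+\<^sup>1 (1 + z)\<^sup>k / (1 - z)\<^sup>k\<^sup>+\<^sup>2\<close>; these power series form a geometric progression in \<open>k\<close>,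
  and summing the resulting recurrence over \<open>k\<close> shows that the double sum obeys the
  recurrence of \<open>L\<close> (\<open>layers_recurrence\<close>).
\<close>

section \<open>Flattened Catalan words, read from left to right\<close>

fun descent_bottoms :: "nat \<Rightarrow> nat list \<Rightarrow> nat list" where
  "descent_bottoms x [] = []"
| "descent_bottoms x (y # ys) = (if y < x then [y] else []) @ descent_bottoms y ys"

fun catalan_steps :: "nat \<Rightarrow> nat list \<Rightarrow> bool" where
  "catalan_steps x [] = True"
| "catalan_steps x (y # ys) = (1 \<le> y \<and> y \<le> x + 1 \<and> catalan_steps y ys)"

text \<open>Comparing only neighbouring letters makes it easy to extend a factor by one position.\<close>

lemma nondecreasing_factor_iff:
  "nondecreasing_factor w i j \<longleftrightarrow>
     i < j \<and> j \<le> length w \<and> (\<forall>k. i \<le> k \<and> Suc k < j \<longrightarrow> w ! k \<le> w ! Suc k)"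
proof -
  have "sorted (take (j - i) (drop i w)) \<longleftrightarrow> (\<forall>k. i \<le> k \<and> Suc k < j \<longrightarrow> w ! k \<le> w ! Suc k)"
    if ij: "i < j" "j \<le> length w"
  proof
    assume s: "sorted (take (j - i) (drop i w))"
    show "\<forall>k. i \<le> k \<and> Suc k < j \<longrightarrow> w ! k \<le> w ! Suc k"
    proof (intro allI impI)
      fix k assume "i \<le> k \<and> Suc k < j"
      then obtain e where e: "k = i + e" "Suc (i + e) < j"
        by (metis le_Suc_ex)
      then have "take (j - i) (drop i w) ! e \<le> take (j - i) (drop i w) ! Suc e"
        using s ij by (subst (asm) sorted_iff_nth_Suc) auto
      then show "w ! k \<le> w ! Suc k"
        using e ij by simp
    qed
  next
    assume "\<forall>k. i \<le> k \<and> Suc k < j \<longrightarrow> w ! k \<le> w ! Suc k"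
    then show "sorted (take (j - i) (drop i w))"
      using ij by (auto simp: sorted_iff_nth_Suc)
  qed
  then show ?thesis
    unfolding nondecreasing_factor_def by blast
qed

text \<open>If the letter at \<open>i\<close> is not below its predecessor, every nondecreasing factor starting at
  \<open>i\<close> can be extended to the left and is not maximal. Otherwise the longest nondecreasing factor
  starting at \<open>i\<close> is a run. Maximality of runs thus becomes a condition on one step, which makes
  the run structure recursive in the word.\<close>

lemma starts_increasing_run_iff:
  "(\<exists>j. increasing_run w i j) \<longleftrightarrow> i < length w \<and> (i = 0 \<or> w ! i < w ! (i - 1))"
proof
  assume "\<exists>j. increasing_run w i j"
  then obtain j where f: "nondecreasing_factor w i j"
    and mx: "\<And>i' j'. i' \<le> i \<Longrightarrow> j \<le> j' \<Longrightarrow> nondecreasing_factor w i' j' \<Longrightarrow> i' = i \<and> j' = j"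
    unfolding increasing_run_def by blast
  have "w ! i < w ! (i - 1)" if "i \<noteq> 0"
  proof (rule ccontr)
    assume "\<not> w ! i < w ! (i - 1)"
    then have "w ! k \<le> w ! Suc k" if "i - 1 \<le> k" "Suc k < j" for k
      using f that \<open>i \<noteq> 0\<close> by (cases "k = i - 1") (auto simp: nondecreasing_factor_iff)
    then have "nondecreasing_factor w (i - 1) j"
      using f by (auto simp: nondecreasing_factor_iff)
    from mx[OF _ _ this] \<open>i \<noteq> 0\<close> show False by simp
  qed
  with f show "i < length w \<and> (i = 0 \<or> w ! i < w ! (i - 1))"
    by (auto simp: nondecreasing_factor_iff)
next
  assume i: "i < length w \<and> (i = 0 \<or> w ! i < w ! (i - 1))"
  let ?J = "{j. nondecreasing_factor w i j}"
  have fin: "finite ?J"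
    by (rule finite_subset[of _ "{..length w}"]) (auto simp: nondecreasing_factor_iff)
  have "Suc i \<in> ?J" using i by (auto simp: nondecreasing_factor_iff)
  then have ne: "?J \<noteq> {}" by blast
  have "increasing_run w i (Max ?J)"
    unfolding increasing_run_def
  proof (intro conjI allI impI)
    show f: "nondecreasing_factor w i (Max ?J)" using Max_in[OF fin ne] by simp
    fix i' j' assume a: "i' \<le> i \<and> Max ?J \<le> j' \<and> nondecreasing_factor w i' j'"
    have "i < j'" using f a by (auto simp: nondecreasing_factor_iff)
    show "i' = i"
    proof (rule ccontr)
      assume "i' \<noteq> i"
      with a have "i' \<le> i - 1" "i \<noteq> 0" by auto
      with a \<open>i < j'\<close> have "w ! (i - 1) \<le> w ! Suc (i - 1)"
        unfolding nondecreasing_factor_iff by auto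
      with i \<open>i \<noteq> 0\<close> show False by simp
    qed
    with a have "j' \<in> ?J" by simp
    with fin have "j' \<le> Max ?J" by simp
    with a show "j' = Max ?J" by simp
  qed
  then show "\<exists>j. increasing_run w i j" by blast
qed

lemma descent_bottoms_conv_filter:
  "descent_bottoms x v = map ((!) v) (filter (\<lambda>i. v ! i < (x # v) ! i) [0..<length v])"
proof (induction v arbitrary: x)
  case (Cons y ys)
  have u: "[0..<length (y # ys)] = 0 # map Suc [0..<length ys]"
    by (simp add: map_Suc_upt upt_conv_Cons del: upt_Suc)
  show ?case
    unfolding u descent_bottoms.simps Cons.IH by (simp add: filter_map comp_def)
qed simp

lemma run_first_letters_Cons: "run_first_letters (x # v) = x # descent_bottoms x v"
proof -
  have u: "[0..<length (x # v)] = 0 # map Suc [0..<length v]"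
    by (simp add: map_Suc_upt upt_conv_Cons del: upt_Suc)
  have "run_first_letters (x # v) =
      map ((!) (x # v)) (filter (\<lambda>i. i = 0 \<or> (x # v) ! i < (x # v) ! (i - 1)) [0..<length (x # v)])"
    unfolding run_first_letters_def starts_increasing_run_iff
    by (rule arg_cong[where f = "map _"], rule filter_cong) auto
  also have "\<dots> = x # descent_bottoms x v"
    unfolding u descent_bottoms_conv_filter by (simp add: filter_map comp_def)
  finally show ?thesis .
qed

lemma catalan_steps_iff:
  "catalan_steps x v \<longleftrightarrow> (\<forall>i < length v. 1 \<le> v ! i \<and> v ! i \<le> (x # v) ! i + 1)"
  by (induction v arbitrary: x) (auto simp: All_less_Suc2)

lemma catalan_word_Cons: "catalan_word (x # v) \<longleftrightarrow> x = 1 \<and> catalan_steps x v"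
  by (auto simp: catalan_word_def catalan_steps_iff)

text \<open>The words that may be appended to a prefix with last letter \<open>x\<close> whose last increasing run
  starts with \<open>m\<close>, such that the result is still a flattened Catalan word.\<close>

definition continuations :: "nat \<Rightarrow> nat \<Rightarrow> nat \<Rightarrow> nat list set" where
  "continuations m x n =
     {v. length v = n \<and> catalan_steps x v \<and> sorted (m # descent_bottoms x v)}"

lemma flattened_catalan_words_Suc:
  "flattened_catalan_words (Suc n) = Cons 1 ` continuations 1 1 n"
proof -
  have "w \<in> flattened_catalan_words (Suc n) \<longleftrightarrow> w \<in> Cons 1 ` continuations 1 1 n" for w
    by (cases w)
      (auto simp: flattened_catalan_words_def continuations_def catalan_word_Cons
         run_first_letters_Cons)
  then show ?thesis by blast
qed

lemma continuations_0 [simp]: "continuations m x 0 = {[]}"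
  by (auto simp: continuations_def)

text \<open>Since the first letters of the runs must not decrease, comparing a new first letter \<open>y\<close> with
  the latest one \<open>m\<close> suffices, and afterwards \<open>y\<close> takes over the role of \<open>m\<close>.\<close>

lemma continuations_Suc:
  assumes "1 \<le> m" "m \<le> x"
  shows "continuations m x (Suc n) =
    (\<Union>y\<in>{m..Suc x}. Cons y ` continuations (if y < x then y else m) y n)"
proof -
  have Cons_iff: "y # v \<in> continuations m x (Suc n) \<longleftrightarrow>
      y \<in> {m..Suc x} \<and> v \<in> continuations (if y < x then y else m) y n" for y v
    using assms
    by (cases "y < x") (auto simp: continuations_def sorted2 simp del: sorted_simps)
  have "v \<in> continuations m x (Suc n) \<longleftrightarrow>
      v \<in> (\<Union>y\<in>{m..Suc x}. Cons y ` continuations (if y < x then y else m) y n)" for v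
  proof (cases v)
    case Nil
    then show ?thesis by (auto simp: continuations_def)
  next
    case (Cons y ys)
    then show ?thesis unfolding Cons Cons_iff by blast
  qed
  then show ?thesis by (rule set_eqI)
qed

lemma finite_continuations: "1 \<le> m \<Longrightarrow> m \<le> x \<Longrightarrow> finite (continuations m x n)"
  by (induction n arbitrary: m x) (auto simp: continuations_Suc)

text \<open>Splitting on the first appended letter: a rise, a repetition, or a descent to a letter
  \<open>y\<close>, which becomes the first letter of a new run. Every enumeration below is an instance of this
  recurrence, with the weight \<open>f\<close> depending on the statistic.\<close>

lemma sum_continuations_Suc:
  fixes f :: "nat list \<Rightarrow> 'a::comm_monoid_add"
  assumes "1 \<le> m"
  shows "(\<Sum>v\<in>continuations m (m + d) (Suc n). f v) =
      (\<Sum>v\<in>continuations m (m + Suc d) n. f (Suc (m + d) # v)) +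
      (\<Sum>v\<in>continuations m (m + d) n. f ((m + d) # v)) +
      (\<Sum>y\<in>{m..<m + d}. \<Sum>v\<in>continuations y y n. f (y # v))"
proof -
  let ?x = "m + d"
  let ?m = "\<lambda>y. if y < ?x then y else m"
  have "(\<Sum>v\<in>continuations m ?x (Suc n). f v) =
      (\<Sum>y\<in>{m..Suc ?x}. \<Sum>v\<in>Cons y ` continuations (?m y) y n. f v)"
    using assms
    by (subst continuations_Suc, simp, simp, subst sum.UNION_disjoint)
      (auto intro!: finite_continuations)
  also have "\<dots> = (\<Sum>y\<in>{m..Suc ?x}. \<Sum>v\<in>continuations (?m y) y n. f (y # v))"
    by (rule sum.cong[OF refl], subst sum.reindex) auto
  also have "{m..Suc ?x} = insert (Suc ?x) (insert ?x {m..<?x})"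
    by auto
  finally show ?thesis
    by (simp add: add.assoc)
qed

section \<open>Consecutive double rises\<close>

text \<open>The number of pairs of consecutive rises, read along a word whose last letter so far is
  \<open>x\<close>; the flag \<open>u\<close> records whether the step leading to \<open>x\<close> was itself a rise.\<close>

fun double_rises :: "bool \<Rightarrow> nat \<Rightarrow> nat list \<Rightarrow> nat" where
  "double_rises u x [] = 0"
| "double_rises u x (y # ys) = of_bool (u \<and> x < y) + double_rises (x < y) y ys"

lemma order_isomorphic_123:
  "order_isomorphic [a, b, c] [1, 2, 3] \<longleftrightarrow> a < b \<and> b < c"
  by (auto simp: order_isomorphic_def All_less_Suc2 numeral_3_eq_3)

lemma finite_occurrences: "finite (occurrences p w)"
  by (rule finite_subset[of _ "{..length w}"]) (auto simp: occurrences_def)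

lemma occurrences_Cons:
  "occurrences p (x # v) =
     {i. i = 0 \<and> length p \<le> Suc (length v) \<and> order_isomorphic (take (length p) (x # v)) p} \<union>
     Suc ` occurrences p v"
proof -
  have "i \<in> occurrences p (x # v) \<longleftrightarrow> i \<in> {i. i = 0 \<and> length p \<le> Suc (length v) \<and>
     order_isomorphic (take (length p) (x # v)) p} \<union> Suc ` occurrences p v" for i
    by (cases i) (auto simp: occurrences_def)
  then show ?thesis by blast
qed

lemma card_occurrences_123_Cons2:
  "card (occurrences [1, 2, 3] (a # x # v)) = double_rises (a < x) x v"
proof (induction v arbitrary: a x)
  case Nil
  then show ?case by (simp add: occurrences_def)
next
  case (Cons y ys)
  have "occurrences [1, 2, 3] (a # x # y # ys) =
      {i. i = 0 \<and> a < x \<and> x < y} \<union> Suc ` occurrences [1, 2, 3] (x # y # ys)"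
    by (subst occurrences_Cons) (simp add: order_isomorphic_123[simplified])
  also have "card \<dots> = card {i::nat. i = 0 \<and> a < x \<and> x < y} +
      card (Suc ` occurrences [1, 2, 3] (x # y # ys))"
    by (rule card_Un_disjoint) (auto intro: finite_occurrences)
  also have "\<dots> = double_rises (a < x) x (y # ys)"
    by (simp add: card_image Cons.IH[simplified])
  finally show ?case .
qed

text \<open>No step leads to the first letter of a word, so the flag starts as \<open>False\<close>.\<close>

lemma card_occurrences_123:
  "card (occurrences [1, 2, 3] (x # v)) = double_rises False x v"
proof (cases v)
  case Nil
  then show ?thesis by (simp add: occurrences_def)
next
  case (Cons y ys)
  then show ?thesis using card_occurrences_123_Cons2[of x y ys] by simp
qed

section \<open>The number of occurrences\<close>

text \<open>The ansatz \<open>a\<^sub>n + b\<^sub>n d\<close> in the recurrence yields \<open>a\<^sub>n\<^sub>+\<^sub>1 = 2 a\<^sub>n + b\<^sub>n\<close> and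
  \<open>b\<^sub>n\<^sub>+\<^sub>1 = a\<^sub>n + 2 b\<^sub>n\<close> with \<open>a\<^sub>0 = 1\<close> and \<open>b\<^sub>0 = 0\<close>; the sum of the two sequences
  is \<open>3\<^sup>n\<close> and their difference is constantly 1.\<close>

lemma card_continuations:
  "1 \<le> m \<Longrightarrow>
     real (card (continuations m (m + d) n)) = ((3 ^ n + 1) + (3 ^ n - 1) * real d) / 2"
proof (induction n arbitrary: m d)
  case (Suc n)
  have "real (card (continuations m (m + d) (Suc n))) =
      (\<Sum>v\<in>continuations m (m + d) (Suc n). 1)"
    by simp
  also have "\<dots> = real (card (continuations m (m + Suc d) n)) +
      real (card (continuations m (m + d) n)) + (\<Sum>y\<in>{m..<m + d}. real (card (continuations y y n)))"
    by (subst sum_continuations_Suc[OF Suc.prems]) simp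
  also have "(\<Sum>y\<in>{m..<m + d}. real (card (continuations y y n))) =
      (\<Sum>y\<in>{m..<m + d}. (3 ^ n + 1) / 2)"
    using Suc.prems by (intro sum.cong refl) (use Suc.IH[where d = 0] in auto)
  finally show ?case
    by (simp only: Suc.IH[OF Suc.prems]) (simp add: field_simps)
qed simp

definition total_double_rises :: "bool \<Rightarrow> nat \<Rightarrow> nat \<Rightarrow> nat \<Rightarrow> real" where
  "total_double_rises u m x n = (\<Sum>v\<in>continuations m x n. real (double_rises u x v))"

lemma total_double_rises_Suc:
  assumes "1 \<le> m"
  shows "total_double_rises u m (m + d) (Suc n) =
      of_bool u * real (card (continuations m (m + Suc d) n)) +
      total_double_rises True m (m + Suc d) n + total_double_rises False m (m + d) n +
      (\<Sum>y\<in>{m..<m + d}. total_double_rises False y y n)"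
  unfolding total_double_rises_def sum_continuations_Suc[OF assms]
  by (simp add: sum.distrib)

text \<open>Whether the step before the continuation was a rise matters only if the continuation begins
  with a rise as well: then it contributes one further occurrence.\<close>

lemma total_double_rises_True:
  assumes "1 \<le> m"
  shows "total_double_rises True m (m + d) (Suc n) =
    total_double_rises False m (m + d) (Suc n) + real (card (continuations m (m + Suc d) n))"
  by (simp only: total_double_rises_Suc[OF assms]) simp

text \<open>With \<open>total_double_rises_True\<close> and \<open>card_continuations\<close>, the flag can be eliminated and the
  ansatz \<open>a\<^sub>n + b\<^sub>n d\<close> gives a linear system with characteristic roots 3 and 1 whose forcing
  term contains \<open>3\<^sup>n\<close>; this resonance produces the factor \<open>n\<close>. The formula is
  stated from length 1 on because that elimination
  fails for the empty continuation, which begins with no step.\<close>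

lemma total_double_rises_False:
  "1 \<le> m \<Longrightarrow> total_double_rises False m (m + d) (Suc n) =
     (2 * real n * 3 ^ n + ((2 * real n - 3) * 3 ^ n + 3) * real d) / 6"
proof (induction n arbitrary: m d)
  case 0
  show ?case
    by (simp only: total_double_rises_Suc[OF 0]) (simp add: total_double_rises_def)
next
  case (Suc n)
  have "(\<Sum>y\<in>{m..<m + d}. total_double_rises False y y (Suc n)) =
      (\<Sum>y\<in>{m..<m + d}. 2 * real n * 3 ^ n / 6)"
    using Suc.prems by (intro sum.cong refl) (use Suc.IH[where d = 0] in auto)
  then show ?case
    unfolding total_double_rises_Suc[OF Suc.prems, of False d "Suc n"]
      total_double_rises_True[OF Suc.prems] card_continuations[OF Suc.prems] Suc.IH[OF Suc.prems]
    by (simp add: field_simps)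
qed

section \<open>The binomial double sum\<close>

text \<open>For fixed \<open>k\<close> this is the coefficient of \<open>z\<^sup>m\<close> in
  \<open>z\<^sup>k\<^sup>+\<^sup>1 (1 + z)\<^sup>k / (1 - z)\<^sup>k\<^sup>+\<^sup>2\<close>. Truncated subtraction does no harm: the terms with
  \<open>i > m\<close> contain \<open>0 choose Suc k\<close>, which vanishes as it should.\<close>

definition layer :: "nat \<Rightarrow> nat \<Rightarrow> nat" where
  "layer m k = (\<Sum>i\<le>k. (k choose i) * ((m - i) choose Suc k))"

text \<open>Pascal's rule. For \<open>i > m\<close> the subtractions truncate, and all three coefficients are zero.\<close>

lemma choose_diff_Suc:
  "(Suc m - i) choose Suc (Suc k) = ((m - i) choose Suc (Suc k)) + ((m - i) choose Suc k)"
  by (cases "i \<le> m") (auto simp: Suc_diff_le)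

text \<open>One factor \<open>1 + z\<close> is split off the numerator, by Pascal's rule for \<open>Suc k choose i\<close>.\<close>

lemma layer_Suc_right:
  "layer m (Suc k) =
     (\<Sum>i\<le>k. (k choose i) * (((m - i) choose Suc (Suc k)) + ((m - Suc i) choose Suc (Suc k))))"
proof -
  let ?g = "\<lambda>i. (m - i) choose Suc (Suc k)"
  have "layer m (Suc k) = ?g 0 + (\<Sum>i\<le>k. (Suc k choose Suc i) * ?g (Suc i))"
    unfolding layer_def by (subst sum.atMost_Suc_shift) simp
  also have "\<dots> = (?g 0 + (\<Sum>i\<le>k. (k choose Suc i) * ?g (Suc i))) + (\<Sum>i\<le>k. (k choose i) * ?g (Suc i))"
    by (simp add: sum.distrib add_mult_distrib)
  also have "?g 0 + (\<Sum>i\<le>k. (k choose Suc i) * ?g (Suc i)) = (\<Sum>i\<le>Suc k. (k choose i) * ?g i)"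
    by (subst sum.atMost_Suc_shift) simp
  also have "\<dots> = (\<Sum>i\<le>k. (k choose i) * ?g i)"
    by simp
  finally show ?thesis
    by (simp add: sum.distrib add_mult_distrib2)
qed

text \<open>In terms of generating functions: the series for \<open>Suc k\<close> times \<open>1 - z\<close> is the series for
  \<open>k\<close> times \<open>z (1 + z)\<close>.\<close>

lemma layer_recurrence:
  "layer (Suc (Suc m)) (Suc k) = layer (Suc m) (Suc k) + layer (Suc m) k + layer m k"
proof -
  have "layer (Suc (Suc m)) (Suc k) =
      (\<Sum>i\<le>k. (k choose i) * (((Suc m - i) choose Suc (Suc k)) + ((m - i) choose Suc (Suc k)))) +
      (\<Sum>i\<le>k. (k choose i) * ((Suc m - i) choose Suc k)) +
      (\<Sum>i\<le>k. (k choose i) * ((m - i) choose Suc k))"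
    unfolding layer_Suc_right[of "Suc (Suc m)"] diff_Suc_Suc sum.distrib[symmetric]
    by (intro sum.cong refl)
      (simp only: choose_diff_Suc[of "Suc m"] choose_diff_Suc[of m] algebra_simps)
  then show ?thesis
    unfolding layer_Suc_right[of "Suc m"] diff_Suc_Suc by (simp only: layer_def)
qed

lemma layer_eq_0: "m \<le> k \<Longrightarrow> layer m k = 0"
  by (auto simp: layer_def binomial_eq_0)

definition layers :: "nat \<Rightarrow> nat" where
  "layers m = (\<Sum>k<m. layer m k)"

text \<open>Different values of \<open>m\<close> can be summed over one common range of \<open>k\<close>.\<close>

lemma layers_eq: "m \<le> N \<Longrightarrow> layers m = (\<Sum>k<N. layer m k)"
  unfolding layers_def by (rule sum.mono_neutral_left) (auto simp: layer_eq_0)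

lemma layers_0 [simp]: "layers 0 = 0"
  and layers_Suc_0 [simp]: "layers (Suc 0) = 1"
  by (simp_all add: layers_def layer_def)

text \<open>The recurrence of the layers is summed over \<open>k\<close>. The layer \<open>k = 0\<close>, whose value at \<open>m\<close> is
  \<open>m\<close>, is not reached by it and accounts for the summand 1.\<close>

lemma layers_recurrence:
  "layers (Suc (Suc m)) = 2 * layers (Suc m) + layers m + 1"
proof -
  let ?N = "Suc (Suc m)"
  have first: "layer m 0 = m" for m
    by (simp add: layer_def)
  \<comment> \<open>One layer more than the other sums, so that the shifted index again ranges below \<open>?N\<close>.\<close>
  have split: "layers k = k + (\<Sum>j<?N. layer k (Suc j))" if "k \<le> ?N" for k
    using that by (subst layers_eq[of _ "Suc ?N"]) (simp_all only: sum.lessThan_Suc_shift first)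
  have "layers ?N = ?N + (\<Sum>j<?N. layer (Suc m) (Suc j) + layer (Suc m) j + layer m j)"
    by (subst split) (simp_all only: layer_recurrence)
  also have "\<dots> = (Suc m + (\<Sum>j<?N. layer (Suc m) (Suc j))) + layers (Suc m) + layers m + 1"
    by (simp only: sum.distrib layers_eq[of "Suc m" ?N] layers_eq[of m ?N])
  also have "Suc m + (\<Sum>j<?N. layer (Suc m) (Suc j)) = layers (Suc m)"
    by (subst split[of "Suc m"]) simp_all
  finally show ?thesis by simp
qed

text \<open>Substituting \<open>k = j - 2\<close> and reversing the inner sum by \<open>i = j - 1 - l\<close>, which leaves
  \<open>k choose (l - 1)\<close> unchanged by symmetry.\<close>

lemma binomial_double_sum_eq_layers:
  "(\<Sum>j = 2..Suc n. \<Sum>l = 1..j - 1. ((j - 2) choose (l - 1)) * ((Suc n - j + l) choose (j - 1))) =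
     layers n"
proof -
  have "(\<Sum>j = 2..Suc n. \<Sum>l = 1..j - 1.
        ((j - 2) choose (l - 1)) * ((Suc n - j + l) choose (j - 1))) =
      (\<Sum>k<n. \<Sum>l = 1..Suc k. (k choose (l - 1)) * ((n - Suc k + l) choose Suc k))"
  proof (rule sum.reindex_bij_witness[of _ "\<lambda>k. k + 2" "\<lambda>j. j - 2"])
    fix j assume "j \<in> {2..Suc n}"
    then have "Suc (j - 2) = j - 1" "n - Suc (j - 2) = Suc n - j"
      by auto
    then show "(\<Sum>l = 1..Suc (j - 2). (j - 2 choose (l - 1)) *
          ((n - Suc (j - 2) + l) choose Suc (j - 2))) =
        (\<Sum>l = 1..j - 1. ((j - 2) choose (l - 1)) * ((Suc n - j + l) choose (j - 1)))"
      by (simp only:)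
  qed auto
  also have "\<dots> = (\<Sum>k<n. layer n k)"
  proof (rule sum.cong[OF refl])
    fix k assume "k \<in> {..<n}"
    then have "k < n" by simp
    show "(\<Sum>l = 1..Suc k. (k choose (l - 1)) * ((n - Suc k + l) choose Suc k)) = layer n k"
      unfolding layer_def
    proof (rule sum.reindex_bij_witness[of _ "\<lambda>i. Suc k - i" "\<lambda>l. Suc k - l"])
      fix l assume l: "l \<in> {1..Suc k}"
      have "k choose (Suc k - l) = k choose (l - 1)"
        using l by (subst binomial_symmetric) auto
      moreover have "n - (Suc k - l) = n - Suc k + l"
        using l \<open>k < n\<close> by simp
      ultimately show "(k choose (Suc k - l)) * ((n - (Suc k - l)) choose Suc k) =
          (k choose (l - 1)) * ((n - Suc k + l) choose Suc k)" by simp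
    qed auto
  qed
  finally show ?thesis by (simp add: layers_def)
qed

section \<open>The number of avoiders\<close>

definition count_double_rise_free :: "bool \<Rightarrow> nat \<Rightarrow> nat \<Rightarrow> nat \<Rightarrow> real" where
  "count_double_rise_free u m x n = (\<Sum>v\<in>continuations m x n. of_bool (double_rises u x v = 0))"

lemma count_double_rise_free_Suc:
  assumes "1 \<le> m"
  shows "count_double_rise_free u m (m + d) (Suc n) =
      of_bool (\<not> u) * count_double_rise_free True m (m + Suc d) n + count_double_rise_free False m (m + d) n +
      (\<Sum>y\<in>{m..<m + d}. count_double_rise_free False y y n)"
  unfolding count_double_rise_free_def sum_continuations_Suc[OF assms] by simp

text \<open>After a rise only a repetition or a descent may follow. Writing \<open>p\<^sub>n + q\<^sub>n d\<close> for the count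
  without a preceding rise, the recurrence becomes
  \<open>p\<^sub>n\<^sub>+\<^sub>2 = p\<^sub>n\<^sub>+\<^sub>1 + 2 p\<^sub>n + q\<^sub>n\<close> and \<open>q\<^sub>n\<^sub>+\<^sub>2 = q\<^sub>n\<^sub>+\<^sub>1 + p\<^sub>n\<^sub>+\<^sub>1 + q\<^sub>n + p\<^sub>n\<close>. It
  is solved by \<open>p\<^sub>n = 1 + L\<^sub>n\<close> and \<open>q\<^sub>n = L\<^sub>n\<^sub>+\<^sub>1 - L\<^sub>n - 1\<close>, where \<open>L\<close> is \<open>layers\<close>. After a
  rise the count is \<open>p\<^sub>n\<^sub>-\<^sub>1 + L\<^sub>n d\<close>; its constant term appears here as
  \<open>L\<^sub>n\<^sub>+\<^sub>1 - 2 L\<^sub>n\<close>, which has the same value and also covers \<open>n = 0\<close>.\<close>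

lemma count_double_rise_free_eq:
  "1 \<le> m \<Longrightarrow> count_double_rise_free u m (m + d) n =
     (if u then real (layers (Suc n)) - 2 * real (layers n) + real (layers n) * real d
      else 1 + real (layers n) + (real (layers (Suc n)) - real (layers n) - 1) * real d)"
proof (induction n arbitrary: u m d)
  case 0
  show ?case by (simp add: count_double_rise_free_def)
next
  case (Suc n)
  have "(\<Sum>y\<in>{m..<m + d}. count_double_rise_free False y y n) = (\<Sum>y\<in>{m..<m + d}. 1 + real (layers n))"
    using Suc.prems by (intro sum.cong refl) (use Suc.IH[where d = 0 and u = False] in auto)
  then show ?case
    unfolding count_double_rise_free_Suc[OF Suc.prems] Suc.IH[OF Suc.prems]
    by (cases u) (simp_all add: layers_recurrence algebra_simps)
qed

section \<open>The enumeration formulas\<close>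

lemma tot_123: "real (tot (Suc n) [1, 2, 3]) = total_double_rises False 1 1 n"
  unfolding tot_def flattened_catalan_words_Suc total_double_rises_def
  by (simp add: sum.reindex card_occurrences_123[simplified])

lemma num_avoiding_123: "real (num_avoiding (Suc n) [1, 2, 3]) = count_double_rise_free False 1 1 n"
proof -
  have av: "avoids (x # v) [1, 2, 3] \<longleftrightarrow> double_rises False x v = 0" for x v
    unfolding avoids_def card_occurrences_123[symmetric] using finite_occurrences by simp
  have "{w \<in> flattened_catalan_words (Suc n). avoids w [1, 2, 3]} =
      Cons 1 ` {v \<in> continuations 1 1 n. double_rises False 1 v = 0}"
    unfolding flattened_catalan_words_Suc using av by auto
  then have "num_avoiding (Suc n) [1, 2, 3] =
      card {v \<in> continuations 1 1 n. double_rises False 1 v = 0}"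
    unfolding num_avoiding_def by (simp add: card_image)
  also have "real \<dots> = count_double_rise_free False 1 1 n"
    unfolding count_double_rise_free_def using finite_continuations[of 1 1 n]
    by (subst sum_of_bool_eq) (simp_all add: Int_def)
  finally show ?thesis .
qed

theorem corollary3p3:
  shows "(\<forall>n::nat. n \<ge> 2 \<longrightarrow>
            real (tot n [1, 2, 3]) = (real n - 2) * 3 powi (int n - 3)) \<and>
         (\<forall>n::nat. n \<ge> 1 \<longrightarrow>
            num_avoiding n [1, 2, 3] =
              1 + (\<Sum>j = 2..n. \<Sum>l = 1..j - 1.
                     ((j - 2) choose (l - 1)) * ((n - j + l) choose (j - 1))))"
proof (intro conjI allI impI)
  fix n :: nat assume "n \<ge> 2"
  then obtain k where n: "n = Suc (Suc k)"
    by (metis Suc_le_D numeral_2_eq_2 Suc_le_mono)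
  have "real (tot n [1, 2, 3]) = 2 * real k * 3 ^ k / 6"
    unfolding n tot_123 using total_double_rises_False[of 1 0 k] by simp
  also have "\<dots> = real k * 3 powi (int k - 1)"
    by (simp add: power_int_diff)
  finally show "real (tot n [1, 2, 3]) = (real n - 2) * 3 powi (int n - 3)"
    by (simp add: n)
next
  fix n :: nat assume "n \<ge> 1"
  then obtain k where n: "n = Suc k"
    by (metis Suc_le_D One_nat_def)
  have "real (num_avoiding n [1, 2, 3]) = real (1 + layers k)"
    unfolding n num_avoiding_123 using count_double_rise_free_eq[of 1 False 0 k] by simp
  then have "num_avoiding n [1, 2, 3] = 1 + layers k"
    by linarith
  then show "num_avoiding n [1, 2, 3] =
              1 + (\<Sum>j = 2..n. \<Sum>l = 1..j - 1.
                     ((j - 2) choose (l - 1)) * ((n - j + l) choose (j - 1)))"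
    unfolding n binomial_double_sum_eq_layers .
qed

end
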